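(* Let $\mathbb F\in\{\mathbb R,\mathbb C\}$. Given any symmetric $t$-$(m,l,\lambda)$ block design $([m],\mathbb S)$ with $\mathbb S=\{\mathcal J_1,\dots,\mathcal J_b\}$, where $[m]=\{1,\dots,m\}$, and a tight $(m,1)$-fusion frame $\Pi=\{\pi_j\}_{j=1}^m$ for $\mathbb F^m$, the family of $n=b$ block projections for $\Pi$, namely $P_i:=\sum_{j\in\mathcal J_i}\pi_j$ for $1\le i\le b$, forms an equiangular tight fusion frame (ETFF) for $\mathbb F^m$.
   Context: A $t$-$(m,l,\lambda)$ block design is a pair $([m],\mathbb S)$, where $\mathbb S$ is a collection of $b=|\mathbb S|$ subsets (blocks) of $[m]$, each of cardinality $l$, such that each element of $[m]$ lies in exactly $r$ blocks and every subset of $[m]$ of cardinality $t$ is contained in exactly $\lambda$ blocks. It is symmetric if $m=b$ or, equivalently, $l=r$. An $(n,l)$-packing for $\mathbb F^m$ is a finite sequence $\{P_j\}_{j=1}^n$ of rank-$l$ orthogonal projections on $\mathbb F^m$; it is an $(n,l)$-fusion frame for $\mathbb F^m$ if $\sum_jP_j$ is positive definite, and it is tight if $\sum_{j=1}^nP_j=\frac{nl}{m}I_m$, where $I_m$ is the $m\times m$ identity matrix. In particular, a tight $(m,1)$-fusion frame for $\mathbb F^m$ consists of the rank-one projections onto the vectors of an orthonormal basis. A packing is equiangular if the set $\{\operatorname{tr}(P_jP_{j'}):j\ne j'\}$ is a singleton. An ETFF is an $(n,l)$-fusion frame that is both equiangular and tight.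
   Formalization: The formal statement assumes t ≥ 2, m ≥ 2, and t ≤ l or l = 1; without this the claim fails, e.g. for the symmetric 1-(4,2,2) design {1,2},{2,3},{3,4},{4,1} (also a 3-(4,2,0) design), and for m = 1, where there are no pairs of distinct indices. *)

theory Defs
  imports "HOL-Analysis.Analysis" "Jordan_Normal_Form.Conjugate"
begin

text \<open>
  The ground set is \<open>{1..m}\<close> and the blocks form a set (no repeated blocks).
  The definition is the literal one: it does not exclude \<open>t > l\<close> (so that
  \<open>lam\<close> is \<open>0\<close>, or arbitrary when \<open>t > m\<close>).
\<close>

definition block_design :: "nat \<Rightarrow> nat \<Rightarrow> nat \<Rightarrow> nat \<Rightarrow> nat set set \<Rightarrow> bool" where
  "block_design t m l lam S \<longleftrightarrow>
     (\<forall>B\<in>S. B \<subseteq> {1..m} \<and> card B = l) \<and>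
     (\<exists>r. \<forall>x\<in>{1..m}. card {B \<in> S. x \<in> B} = r) \<and>
     (\<forall>T. T \<subseteq> {1..m} \<and> card T = t \<longrightarrow> card {B \<in> S. T \<subseteq> B} = lam)"

definition symmetric_block_design :: "nat \<Rightarrow> nat \<Rightarrow> nat \<Rightarrow> nat \<Rightarrow> nat set set \<Rightarrow> bool" where
  "symmetric_block_design t m l lam S \<longleftrightarrow> block_design t m l lam S \<and> card S = m"

text \<open>
  The class \<open>conjugatable_ordered_field\<close> treats the real and the complex field uniformly:
  \<open>conjugate\<close> is the identity on the reals and \<open>cnj\<close> on the complex numbers, and
  on the complex numbers \<open>0 < z\<close> means that \<open>z\<close> is real and positive.
  Matrices on the \<open>m\<close>-dimensional space have index type \<open>'m\<close> with \<open>m = CARD('m)\<close>.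
\<close>

definition adjoint_matrix :: "'a::conjugatable_ordered_field ^ 'n ^ 'm \<Rightarrow> 'a ^ 'm ^ 'n" where
  "adjoint_matrix A = (\<chi> i j. conjugate (A $ j $ i))"

definition orthogonal_projection :: "'a::conjugatable_ordered_field ^ 'm ^ 'm \<Rightarrow> bool" where
  "orthogonal_projection P \<longleftrightarrow> P ** P = P \<and> adjoint_matrix P = P"

definition positive_definite :: "'a::conjugatable_ordered_field ^ 'm ^ 'm \<Rightarrow> bool" where
  "positive_definite A \<longleftrightarrow> adjoint_matrix A = A \<and>
     (\<forall>x. x \<noteq> 0 \<longrightarrow> 0 < (\<Sum>i\<in>UNIV. conjugate (x $ i) * (A *v x) $ i))"

text \<open>A finite sequence of length \<open>n\<close> is given by the values of a function on \<open>{1..n}\<close>.\<close>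

definition packing ::
    "nat \<Rightarrow> nat \<Rightarrow> (nat \<Rightarrow> 'a::conjugatable_ordered_field ^ 'm ^ 'm) \<Rightarrow> bool" where
  "packing n l P \<longleftrightarrow> (\<forall>j\<in>{1..n}. orthogonal_projection (P j) \<and> rank (P j) = l)"

definition fusion_frame ::
    "nat \<Rightarrow> nat \<Rightarrow> (nat \<Rightarrow> 'a::conjugatable_ordered_field ^ 'm ^ 'm) \<Rightarrow> bool" where
  "fusion_frame n l P \<longleftrightarrow> packing n l P \<and> positive_definite (\<Sum>j=1..n. P j)"

definition tight_fusion_frame ::
    "nat \<Rightarrow> nat \<Rightarrow> (nat \<Rightarrow> 'a::conjugatable_ordered_field ^ 'm ^ 'm) \<Rightarrow> bool" where
  "tight_fusion_frame n l P \<longleftrightarrow> fusion_frame n l P \<and>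
     (\<Sum>j=1..n. P j) = mat (of_nat (n * l) / of_nat CARD('m))"

definition equiangular ::
    "nat \<Rightarrow> (nat \<Rightarrow> 'a::conjugatable_ordered_field ^ 'm ^ 'm) \<Rightarrow> bool" where
  "equiangular n P \<longleftrightarrow>
     is_singleton {trace (P j ** P k) | j k. j \<in> {1..n} \<and> k \<in> {1..n} \<and> j \<noteq> k}"

definition ETFF ::
    "nat \<Rightarrow> nat \<Rightarrow> (nat \<Rightarrow> 'a::conjugatable_ordered_field ^ 'm ^ 'm) \<Rightarrow> bool" where
  "ETFF n l P \<longleftrightarrow> tight_fusion_frame n l P \<and> equiangular n P"

definition block_projections ::
    "(nat \<Rightarrow> nat set) \<Rightarrow> (nat \<Rightarrow> 'a::conjugatable_ordered_field ^ 'm ^ 'm)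
      \<Rightarrow> nat \<Rightarrow> 'a ^ 'm ^ 'm" where
  "block_projections J \<pi> i = (\<Sum>j\<in>J i. \<pi> j)"

end

theory Submission
  imports Defs
begin

text \<open>
  Counting pairs \<open>T \<subseteq> B\<close> shows that a \<open>t\<close>-design with \<open>2 \<le> t \<le> l\<close> is a \<open>2\<close>-design with some
  index \<open>\<lambda>\<close>. In a symmetric \<open>2\<close>-design, for a fixed block \<open>B\<^sub>0\<close>, the first two moments of
  \<open>B \<mapsto> |B \<inter> B\<^sub>0|\<close> give \<open>\<Sum>\<^bsub>B \<noteq> B\<^sub>0\<^esub> (|B \<inter> B\<^sub>0| - \<lambda>)\<^sup>2 = 0\<close>, so any two blocks meet in \<open>\<lambda>\<close> points.
  If orthogonal projections \<open>\<pi>\<^sub>j\<close> sum to the identity, then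
  \<open>\<Sum>\<^bsub>j \<noteq> k\<^esub> \<pi>\<^sub>k \<pi>\<^sub>j (\<pi>\<^sub>k \<pi>\<^sub>j)\<^sup>* = \<pi>\<^sub>k - \<pi>\<^sub>k = 0\<close>, and taking traces gives \<open>\<pi>\<^sub>k \<pi>\<^sub>j = 0\<close>. Hence the
  trace of a product of two block projections is the size of the intersection of the blocks.
\<close>

section \<open>Block designs\<close>

lemma sum_card_swap:
  assumes "finite A" "finite B"
  shows "(\<Sum>a\<in>A. card {b\<in>B. R a b}) = (\<Sum>b\<in>B. card {a\<in>A. R a b})"
proof -
  have "(\<Sum>a\<in>A. card {b\<in>B. R a b}) = (\<Sum>a\<in>A. \<Sum>b\<in>B. if R a b then 1 else 0)"
    using assms by (simp add: sum.inter_filter[symmetric])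
  also have "\<dots> = (\<Sum>b\<in>B. \<Sum>a\<in>A. if R a b then 1 else 0)"
    by (rule sum.swap)
  also have "\<dots> = (\<Sum>b\<in>B. card {a\<in>A. R a b})"
    using assms by (simp add: sum.inter_filter[symmetric])
  finally show ?thesis .
qed

text \<open>Deleting \<open>U\<close> turns such a \<open>T\<close> into an arbitrary subset of
  \<open>B - U\<close> of size \<open>t - card U\<close>. For \<open>t < card U\<close> the left
  side would be 0, but truncated subtraction would make the right side 1.\<close>

lemma card_sets_between:
  assumes "finite B" "U \<subseteq> B" "card U \<le> t"
  shows "card {T. U \<subseteq> T \<and> T \<subseteq> B \<and> card T = t} = (card B - card U) choose (t - card U)"
proof -
  have finU: "finite U"
    using assms finite_subset by blast
  have "bij_betw (\<lambda>T. U \<union> T) {T. T \<subseteq> B - U \<and> card T = t - card U}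
          {T. U \<subseteq> T \<and> T \<subseteq> B \<and> card T = t}"
  proof (rule bij_betw_byWitness[where f' = "\<lambda>T. T - U"])
    show "(\<lambda>T. U \<union> T) ` {T. T \<subseteq> B - U \<and> card T = t - card U}
            \<subseteq> {T. U \<subseteq> T \<and> T \<subseteq> B \<and> card T = t}"
    proof clarify
      fix T assume T: "T \<subseteq> B - U" "card T = t - card U"
      then have "card (U \<union> T) = card U + card T"
        using assms finU by (intro card_Un_disjoint) (auto intro: finite_subset)
      then show "U \<subseteq> U \<union> T \<and> U \<union> T \<subseteq> B \<and> card (U \<union> T) = t"
        using T assms by auto
    qed
    show "(\<lambda>T. T - U) ` {T. U \<subseteq> T \<and> T \<subseteq> B \<and> card T = t}
            \<subseteq> {T. T \<subseteq> B - U \<and> card T = t - card U}"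
      using finU by (auto simp: card_Diff_subset)
  qed auto
  then have "card {T. U \<subseteq> T \<and> T \<subseteq> B \<and> card T = t} = card {T. T \<subseteq> B - U \<and> card T = t - card U}"
    by (rule bij_betw_same_card[symmetric])
  also have "\<dots> = (card B - card U) choose (t - card U)"
    using assms finU by (simp add: n_subsets card_Diff_subset)
  finally show ?thesis .
qed

section \<open>Block designs and their strength\<close>

lemma block_design_subset: "block_design t m l lam S \<Longrightarrow> B \<in> S \<Longrightarrow> B \<subseteq> {1..m}"
  by (simp add: block_design_def)

lemma block_design_card: "block_design t m l lam S \<Longrightarrow> B \<in> S \<Longrightarrow> card B = l"
  by (simp add: block_design_def)

lemma block_design_index:
  "block_design t m l lam S \<Longrightarrow> T \<subseteq> {1..m} \<Longrightarrow> card T = t \<Longrightarrow> card {B \<in> S. T \<subseteq> B} = lam"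
  by (simp add: block_design_def)

text \<open>Block size and replication do not mention the strength, so only the index condition has
  to be established anew.\<close>

lemma block_design_change_index:
  assumes "block_design t m l lam S"
    and "\<And>T. T \<subseteq> {1..m} \<Longrightarrow> card T = s \<Longrightarrow> card {B \<in> S. T \<subseteq> B} = \<mu>"
  shows "block_design s m l \<mu> S"
  using assms by (simp add: block_design_def)

lemma block_design_finite:
  assumes "block_design t m l lam S"
  shows "finite S"
proof (rule finite_subset)
  show "S \<subseteq> Pow {1..m}"
    using block_design_subset[OF assms] by blast
qed simp

lemma block_design_lower_strength:
  assumes D: "block_design t m l lam S" and "s \<le> t" "t \<le> l"
  shows "\<exists>\<mu>. block_design s m l \<mu> S"
proof -
  \<comment> \<open>Count pairs \<open>(T, B)\<close> with
    \<open>U \<subseteq> T \<subseteq> B\<close> and \<open>card T = t\<close>: each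
    \<open>T\<close> lies in \<open>lam\<close> blocks, each block containing \<open>U\<close> has
    \<open>(l - s) choose (t - s)\<close> such \<open>T\<close>. The divisor is positive because
    \<open>t \<le> l\<close>, and the division is exact when some \<open>U\<close> exists.\<close>
  let ?\<mu> = "lam * ((m - s) choose (t - s)) div ((l - s) choose (t - s))"
  have "card {B \<in> S. U \<subseteq> B} = ?\<mu>" if U: "U \<subseteq> {1..m}" "card U = s" for U
  proof -
    let ?\<T> = "{T. U \<subseteq> T \<and> T \<subseteq> {1..m} \<and> card T = t}"
    have fin: "finite ?\<T>"
      by (rule finite_subset[of _ "Pow {1..m}"]) auto
    have "lam * ((m - s) choose (t - s)) = (\<Sum>T\<in>?\<T>. card {B \<in> S. T \<subseteq> B})"
      using U card_sets_between[of "{1..m}" U t] \<open>s \<le> t\<close> block_design_index[OF D]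
      by simp
    also have "\<dots> = (\<Sum>B\<in>S. card {T \<in> ?\<T>. T \<subseteq> B})"
      using fin block_design_finite[OF D] by (rule sum_card_swap)
    also have "\<dots> = (\<Sum>B\<in>S. if U \<subseteq> B then (l - s) choose (t - s) else 0)"
    proof (rule sum.cong[OF refl])
      fix B assume B: "B \<in> S"
      then have B': "B \<subseteq> {1..m}" "card B = l"
        using block_design_subset[OF D] block_design_card[OF D] by auto
      then have *: "{T \<in> ?\<T>. T \<subseteq> B} = {T. U \<subseteq> T \<and> T \<subseteq> B \<and> card T = t}"
        by auto
      show "card {T \<in> ?\<T>. T \<subseteq> B} = (if U \<subseteq> B then (l - s) choose (t - s) else 0)"
      proof (cases "U \<subseteq> B")
        case True
        then show ?thesis
          unfolding * using card_sets_between[of B U t] B' U \<open>s \<le> t\<close> finite_subset[OF B'(1)]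
          by simp
      next
        case False
        then have "{T \<in> ?\<T>. T \<subseteq> B} = {}"
          by auto
        then show ?thesis
          using False by simp
      qed
    qed
    also have "\<dots> = card {B \<in> S. U \<subseteq> B} * ((l - s) choose (t - s))"
      using block_design_finite[OF D] by (simp add: sum.inter_filter[symmetric])
    finally show ?thesis
      using assms by simp
  qed
  then have "block_design s m l ?\<mu> S"
    by (rule block_design_change_index[OF D])
  then show ?thesis ..
qed

text \<open>Serves the case \<open>l = 1\<close>, where a strength \<open>t\<close> of at least 2
  exceeds the block size and cannot be lowered by the previous count.\<close>

lemma block_design_singletons:
  assumes "block_design t m 1 lam S"
  shows "block_design 2 m 1 0 S"
proof -
  have no_pair: "card {B \<in> S. T \<subseteq> B} = 0" if "card T = 2" for T
  proof -
    have "\<not> T \<subseteq> B" if "B \<in> S" for B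
    proof
      assume "T \<subseteq> B"
      moreover have "finite B" "card B = 1"
        using block_design_subset[OF assms that] block_design_card[OF assms that]
        by (auto intro: finite_subset)
      ultimately have "card T \<le> 1"
        using card_mono[of B T] by simp
      with \<open>card T = 2\<close> show False
        by simp
    qed
    then have "{B \<in> S. T \<subseteq> B} = {}"
      by auto
    then show ?thesis
      by (simp only: card.empty)
  qed
  show ?thesis
    by (rule block_design_change_index[OF assms no_pair])
qed

section \<open>Symmetric designs and their block intersections\<close>

lemma symmetric_block_design_replication:
  assumes "symmetric_block_design t m l lam S" "x \<in> {1..m}"
  shows "card {B \<in> S. x \<in> B} = l"
proof -
  have D: "block_design t m l lam S" and b: "card S = m"
    using assms by (auto simp: symmetric_block_design_def)
  obtain r where r: "\<forall>x\<in>{1..m}. card {B \<in> S. x \<in> B} = r"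
    using D by (auto simp: block_design_def)
  \<comment> \<open>Count incidences by points and by blocks. There are \<open>m\<close> of each,
    and \<open>m\<close> cancels because the point \<open>x\<close> makes it positive.\<close>
  have "m * r = (\<Sum>x\<in>{1..m}. card {B \<in> S. x \<in> B})"
    using r by simp
  also have "\<dots> = (\<Sum>B\<in>S. card {x \<in> {1..m}. x \<in> B})"
    by (rule sum_card_swap) (use block_design_finite[OF D] in auto)
  also have "\<dots> = (\<Sum>B\<in>S. l)"
  proof (rule sum.cong[OF refl])
    fix B assume B: "B \<in> S"
    then have "{x \<in> {1..m}. x \<in> B} = B"
      using block_design_subset[OF D B] by blast
    moreover have "card B = l"
      using block_design_card[OF D B] .
    ultimately show "card {x \<in> {1..m}. x \<in> B} = l"
      by simp
  qed
  also have "\<dots> = m * l"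
    using b by simp
  finally have "r = l"
    using assms(2) by simp
  then show ?thesis
    using r assms(2) by simp
qed

text \<open>Count pairs \<open>(y, B)\<close> with \<open>y\<close> different from \<open>x\<close>
  and both points in \<open>B\<close>. This is the classical relation between index and replication
  number, the latter being \<open>l\<close> here.\<close>

lemma symmetric_2_design_index:
  assumes "symmetric_block_design 2 m l lam S" "x \<in> {1..m}"
  shows "(m - 1) * lam = l * (l - 1)"
proof -
  have D: "block_design 2 m l lam S"
    using assms by (auto simp: symmetric_block_design_def)
  have finS: "finite S"
    using D by (rule block_design_finite)
  have "(m - 1) * lam = (\<Sum>y\<in>{1..m}-{x}. card {B \<in> S. {x, y} \<subseteq> B})"
  proof -
    have "card {B \<in> S. {x, y} \<subseteq> B} = lam" if "y \<in> {1..m} - {x}" for y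
    proof -
      have "{x, y} \<subseteq> {1..m} \<and> card {x, y} = 2"
        using that assms(2) by auto
      then show ?thesis
        using block_design_index[OF D] by blast
    qed
    then show ?thesis
      using assms(2) by simp
  qed
  also have "\<dots> = (\<Sum>B\<in>S. card {y \<in> {1..m}-{x}. {x, y} \<subseteq> B})"
    by (rule sum_card_swap) (use finS in auto)
  also have "\<dots> = (\<Sum>B\<in>S. if x \<in> B then l - 1 else 0)"
  proof (rule sum.cong[OF refl])
    fix B assume B: "B \<in> S"
    then have "B \<subseteq> {1..m}" "card B = l"
      using block_design_subset[OF D] block_design_card[OF D] by blast+
    moreover from this have "{y \<in> {1..m}-{x}. {x, y} \<subseteq> B} = (if x \<in> B then B - {x} else {})"
      by auto
    ultimately show "card {y \<in> {1..m}-{x}. {x, y} \<subseteq> B} = (if x \<in> B then l - 1 else 0)"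
      by (simp add: card_Diff_singleton)
  qed
  also have "\<dots> = card {B \<in> S. x \<in> B} * (l - 1)"
    using finS by (simp add: sum.inter_filter[symmetric])
  finally show ?thesis
    using symmetric_block_design_replication[OF assms] by simp
qed

lemma symmetric_2_design_inter_card:
  assumes sym: "symmetric_block_design 2 m l lam S"
    and "B0 \<in> S" "B1 \<in> S" "B0 \<noteq> B1"
  shows "card (B0 \<inter> B1) = lam"
proof -
  have D: "block_design 2 m l lam S" and b: "card S = m"
    using sym by (auto simp: symmetric_block_design_def)
  have finS: "finite S"
    using D by (rule block_design_finite)
  have B0: "B0 \<subseteq> {1..m}" "card B0 = l"
    using block_design_subset[OF D \<open>B0 \<in> S\<close>] block_design_card[OF D \<open>B0 \<in> S\<close>] by auto
  then have finB0: "finite B0"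
    by (auto intro: finite_subset)
  have inter: "{x \<in> B0. x \<in> B} = B0 \<inter> B" for B
    by auto
  have replication: "card {B \<in> S. x \<in> B} = l" if "x \<in> B0" for x
    using symmetric_block_design_replication[OF sym] B0 that by blast
  have "m \<noteq> 0"
    using b \<open>B0 \<in> S\<close> finS card_0_eq by blast
  then have "(m - 1) * lam = l * (l - 1)"
    by (intro symmetric_2_design_index[OF sym, of 1]) simp
  then have index: "int (m - 1) * int lam = int l * int (l - 1)"
    by (metis of_nat_mult)
  have m1: "int (m - 1) = int m - 1"
    using \<open>m \<noteq> 0\<close> by auto
  \<comment> \<open>For \<open>l = 0\<close> the truncated \<open>l - 1\<close> differs from the
    integer one, but the factor \<open>int l\<close> annihilates both.\<close>
  have l1: "int l * int (l - 1) = int l * (int l - 1)"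
    by (cases l) auto
  have first: "(\<Sum>B\<in>S. int (card (B0 \<inter> B))) = int l * int l"
  proof -
    have "(\<Sum>B\<in>S. card (B0 \<inter> B)) = (\<Sum>x\<in>B0. card {B \<in> S. x \<in> B})"
      using sum_card_swap[OF finB0 finS, of "\<lambda>x B. x \<in> B"] by (simp add: inter)
    also have "\<dots> = l * l"
      using replication B0 by simp
    finally show ?thesis
      by (metis of_nat_mult of_nat_sum)
  qed
  \<comment> \<open>The square counts ordered pairs of points of \<open>B0\<close> lying in
    \<open>B\<close>. Summed over blocks, a diagonal pair contributes the replication number
    \<open>l\<close>, any other pair \<open>lam\<close>.\<close>
  have second: "(\<Sum>B\<in>S. (int (card (B0 \<inter> B)))\<^sup>2) = int l * (int l + int (l - 1) * int lam)"
  proof -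
    have "(\<Sum>B\<in>S. (card (B0 \<inter> B))\<^sup>2) = (\<Sum>B\<in>S. card {p \<in> B0 \<times> B0. {fst p, snd p} \<subseteq> B})"
    proof (rule sum.cong[OF refl])
      fix B
      have "{p \<in> B0 \<times> B0. {fst p, snd p} \<subseteq> B} = (B0 \<inter> B) \<times> (B0 \<inter> B)"
        by auto
      then show "(card (B0 \<inter> B))\<^sup>2 = card {p \<in> B0 \<times> B0. {fst p, snd p} \<subseteq> B}"
        by (simp add: card_cartesian_product power2_eq_square)
    qed
    also have "\<dots> = (\<Sum>p\<in>B0 \<times> B0. card {B \<in> S. {fst p, snd p} \<subseteq> B})"
      using sum_card_swap[of "B0 \<times> B0" S "\<lambda>p B. {fst p, snd p} \<subseteq> B"] finB0 finS by simp
    also have "\<dots> = (\<Sum>x\<in>B0. \<Sum>y\<in>B0. card {B \<in> S. {x, y} \<subseteq> B})"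
      by (simp add: sum.cartesian_product case_prod_beta)
    also have "\<dots> = (\<Sum>x\<in>B0. l + (l - 1) * lam)"
    proof (rule sum.cong[OF refl])
      fix x assume x: "x \<in> B0"
      have "card {B \<in> S. {x, y} \<subseteq> B} = lam" if "y \<in> B0 - {x}" for y
      proof -
        have "{x, y} \<subseteq> {1..m} \<and> card {x, y} = 2"
          using that x B0 by auto
        then show ?thesis
          using block_design_index[OF D] by blast
      qed
      then show "(\<Sum>y\<in>B0. card {B \<in> S. {x, y} \<subseteq> B}) = l + (l - 1) * lam"
        using x finB0 B0 replication[OF x] by (simp add: sum.remove)
    qed
    also have "\<dots> = l * (l + (l - 1) * lam)"
      using B0 by simp
    finally have "int (\<Sum>B\<in>S. (card (B0 \<inter> B))\<^sup>2) = int (l * (l + (l - 1) * lam))"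
      by (rule arg_cong)
    then show ?thesis
      by (simp only: of_nat_sum of_nat_power of_nat_mult of_nat_add)
  qed
  have second': "(\<Sum>B\<in>S. (int (card (B0 \<inter> B)))\<^sup>2)
      = int l * int l + int l * (int l - 1) * int lam"
    by (simp only: second distrib_left mult.assoc[symmetric] l1)
  have "(\<Sum>B\<in>S. (int (card (B0 \<inter> B)) - int lam)\<^sup>2)
      = (\<Sum>B\<in>S. (int (card (B0 \<inter> B)))\<^sup>2) - 2 * int lam * (\<Sum>B\<in>S. int (card (B0 \<inter> B)))
        + int m * (int lam)\<^sup>2"
    using b by (simp add: power2_diff sum.distrib sum_subtractf sum_distrib_left mult_ac)
  \<comment> \<open>The expression is arranged so that the last bracket vanishes by
    \<open>index\<close>. What remains is exactly the term of \<open>B0\<close> itself, so all other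
    squares sum to zero.\<close>
  also have "\<dots> = (int l - int lam)\<^sup>2 + int lam * (int (m - 1) * int lam - int l * int (l - 1))"
    unfolding first second' m1 l1 by (simp add: algebra_simps power2_eq_square)
  also have "\<dots> = (int (card (B0 \<inter> B0)) - int lam)\<^sup>2"
    using index B0 by simp
  finally have "(\<Sum>B\<in>S - {B0}. (int (card (B0 \<inter> B)) - int lam)\<^sup>2) = 0"
    using finS \<open>B0 \<in> S\<close> by (simp add: sum.remove)
  then have "(int (card (B0 \<inter> B1)) - int lam)\<^sup>2 = 0"
    using finS assms by (subst (asm) sum_nonneg_eq_0_iff) auto
  then show ?thesis
    by simp
qed

section \<open>Orthogonal projections\<close>

lemma matrix_mult_sum_left:
  fixes A :: "'b \<Rightarrow> 'a::semiring_1 ^ 'n ^ 'm"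
  shows "(\<Sum>i\<in>I. A i) ** C = (\<Sum>i\<in>I. A i ** C)"
  by (simp add: matrix_matrix_mult_def vec_eq_iff sum_distrib_right sum.swap[of _ I])

lemma matrix_mult_sum_right:
  fixes A :: "'b \<Rightarrow> 'a::semiring_1 ^ 'n ^ 'm"
  shows "C ** (\<Sum>i\<in>I. A i) = (\<Sum>i\<in>I. C ** A i)"
  by (simp add: matrix_matrix_mult_def vec_eq_iff sum_distrib_left sum.swap[of _ I])

lemma trace_sum:
  fixes A :: "'b \<Rightarrow> 'a::comm_semiring_1 ^ 'n ^ 'n"
  shows "trace (\<Sum>i\<in>I. A i) = (\<Sum>i\<in>I. trace (A i))"
  unfolding trace_def by (simp add: sum.swap[of _ I])

lemma adjoint_matrix_sum:
  "adjoint_matrix (\<Sum>i\<in>I. A i) = (\<Sum>i\<in>I. adjoint_matrix (A i))"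
  by (cases "finite I") (simp_all add: adjoint_matrix_def vec_eq_iff sum_conjugate)

lemma adjoint_matrix_mult:
  "adjoint_matrix (A ** B) = adjoint_matrix B ** adjoint_matrix A"
  by (simp add: adjoint_matrix_def matrix_matrix_mult_def vec_eq_iff sum_conjugate
      conjugate_dist_mul mult.commute)

text \<open>This trace is the squared Frobenius norm of \<open>A\<close>, which is the source of its
  nonnegativity and definiteness.\<close>

lemma trace_mult_adjoint:
  "trace (A ** adjoint_matrix A) = (\<Sum>i\<in>UNIV. \<Sum>j\<in>UNIV. A $ i $ j * conjugate (A $ i $ j))"
  by (simp add: trace_def adjoint_matrix_def matrix_matrix_mult_def)

lemma trace_mult_adjoint_nonneg: "0 \<le> trace (A ** adjoint_matrix A)"
  by (simp add: trace_mult_adjoint sum_nonneg conjugate_square_positive)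

lemma trace_mult_adjoint_eq_0:
  assumes "trace (A ** adjoint_matrix A) = 0"
  shows "A = 0"
proof -
  have "A $ i $ j * conjugate (A $ i $ j) = 0" for i j
    using assms unfolding trace_mult_adjoint
    by (simp add: sum_nonneg_eq_0_iff sum_nonneg conjugate_square_positive)
  then show ?thesis
    by (simp add: vec_eq_iff)
qed

lemma projections_sum_id_orthogonal:
  fixes \<pi> :: "'b \<Rightarrow> 'a::conjugatable_ordered_field ^ 'm ^ 'm"
  assumes "finite I" and proj: "\<And>i. i \<in> I \<Longrightarrow> orthogonal_projection (\<pi> i)"
    and sum: "(\<Sum>i\<in>I. \<pi> i) = mat 1"
    and "j \<in> I" "k \<in> I" "j \<noteq> k"
  shows "\<pi> j ** \<pi> k = 0"
proof -
  have idem: "\<pi> i ** \<pi> i = \<pi> i" and adj: "adjoint_matrix (\<pi> i) = \<pi> i" if "i \<in> I" for i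
    using proj[OF that] by (auto simp: orthogonal_projection_def)
  \<comment> \<open>Self-adjointness reverses the second product, and idempotence merges the two
    middle factors.\<close>
  have AA: "(\<pi> j ** \<pi> i) ** adjoint_matrix (\<pi> j ** \<pi> i) = \<pi> j ** \<pi> i ** \<pi> j" if "i \<in> I" for i
    using idem[OF that] adj[OF that] adj[OF \<open>j \<in> I\<close>]
    by (metis adjoint_matrix_mult matrix_mul_assoc)
  \<comment> \<open>Compress the identity by \<open>\<pi> j\<close>. The summand
    \<open>i = j\<close> is \<open>\<pi> j\<close> itself and cancels, leaving nonnegative traces
    with sum zero.\<close>
  have "\<pi> j = \<pi> j ** (\<Sum>i\<in>I. \<pi> i) ** \<pi> j"
    using idem \<open>j \<in> I\<close> by (simp add: sum)
  also have "\<dots> = (\<Sum>i\<in>I. \<pi> j ** \<pi> i ** \<pi> j)"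
    by (simp add: matrix_mult_sum_left matrix_mult_sum_right)
  also have "\<dots> = \<pi> j + (\<Sum>i\<in>I - {j}. \<pi> j ** \<pi> i ** \<pi> j)"
    using assms idem by (simp add: sum.remove)
  finally have "(\<Sum>i\<in>I - {j}. trace (\<pi> j ** \<pi> i ** \<pi> j)) = 0"
    by (simp add: trace_sum[symmetric] trace_0[unfolded mat_0])
  moreover have "trace (\<pi> j ** \<pi> i ** \<pi> j) \<ge> 0" if "i \<in> I" for i
    using trace_mult_adjoint_nonneg[of "\<pi> j ** \<pi> i"] AA[OF that] by simp
  ultimately have "trace (\<pi> j ** \<pi> k ** \<pi> j) = 0"
    using assms by (subst (asm) sum_nonneg_eq_0_iff) auto
  then show ?thesis
    using AA[OF \<open>k \<in> I\<close>] by (intro trace_mult_adjoint_eq_0) simp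
qed

section \<open>Rank-one matrices as bilinear outer products, without conjugation, over an arbitrary
  field\<close>

definition outer_product :: "'a::times ^ 'n \<Rightarrow> 'a ^ 'm \<Rightarrow> 'a ^ 'm ^ 'n" where
  "outer_product u v = (\<chi> i j. u $ i * v $ j)"

text \<open>The row space has a one-element basis \<open>v\<close>, and \<open>u\<close> collects
  the coefficients of the rows with respect to it.\<close>

lemma rank_1_outer_product:
  fixes A :: "'a::field ^ 'n ^ 'm"
  assumes "rank A = 1"
  obtains u v where "A = outer_product u v"
proof -
  obtain B where B: "rows A \<subseteq> vec.span B" "card B = vec.dim (rows A)"
    using vec.basis_exists by metis
  then obtain v where v: "B = {v}"
    using assms by (auto simp: row_rank_def_gen card_1_singleton_iff)
  have "\<exists>c. row i A = c *s v" for i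
    using B(1) unfolding v vec.span_singleton rows_def by auto
  then obtain c where c: "\<And>i. row i A = c i *s v"
    by metis
  have "A $ i = c i *s v" for i
    using c[of i] by (simp add: row_def)
  then have "A = outer_product (\<chi> i. c i) v"
    by (simp add: outer_product_def vec_eq_iff)
  then show ?thesis ..
qed

lemma outer_product_mult:
  fixes u :: "'a::comm_semiring_1 ^ 'n"
  shows "outer_product u v ** outer_product w z
    = (\<chi> i j. (\<Sum>k\<in>UNIV. v $ k * w $ k) * (u $ i * z $ j))"
  by (simp add: outer_product_def matrix_matrix_mult_def vec_eq_iff sum_distrib_left sum_distrib_right
      mult_ac)

lemma trace_outer_product:
  fixes u :: "'a::comm_semiring_1 ^ 'n"
  shows "trace (outer_product u v) = (\<Sum>k\<in>UNIV. v $ k * u $ k)"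
  by (simp add: trace_def outer_product_def mult.commute)

text \<open>The vectors \<open>v j\<close> form a basis of the row space: the family
  \<open>z\<close>, dual to \<open>v\<close>, gives independence, and the family \<open>w\<close>,
  dual to \<open>u\<close>, recovers each \<open>v j\<close> from the rows.\<close>

lemma rank_sum_outer_products:
  fixes u :: "'b \<Rightarrow> 'a::field ^ 'm" and v :: "'b \<Rightarrow> 'a ^ 'n"
  assumes "finite I"
    and dual: "\<And>j k. j \<in> I \<Longrightarrow> k \<in> I \<Longrightarrow>
      (\<Sum>i\<in>UNIV. w j $ i * u k $ i) = (if j = k then 1 else 0)"
    and dual': "\<And>j k. j \<in> I \<Longrightarrow> k \<in> I \<Longrightarrow>
      (\<Sum>i\<in>UNIV. v j $ i * z k $ i) = (if j = k then 1 else 0)"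
  shows "rank (\<Sum>j\<in>I. outer_product (u j) (v j)) = card I"
proof -
  let ?P = "\<Sum>j\<in>I. outer_product (u j) (v j)"
  have row: "row i ?P = (\<Sum>j\<in>I. u j $ i *s v j)" for i
    by (simp add: row_def outer_product_def vec_eq_iff)
  \<comment> \<open>Pairing with \<open>z k\<close> reads off the coefficient at
    \<open>v k\<close>.\<close>
  have coord: "(\<Sum>i\<in>UNIV. (\<Sum>j\<in>I. c j *s v j) $ i * z k $ i) = c k" if "k \<in> I" for c k
  proof -
    have "(\<Sum>i\<in>UNIV. (\<Sum>j\<in>I. c j *s v j) $ i * z k $ i)
        = (\<Sum>j\<in>I. c j * (\<Sum>i\<in>UNIV. v j $ i * z k $ i))"
      by (simp add: sum_distrib_left sum_distrib_right sum.swap[of _ I] mult.assoc)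
    also have "\<dots> = (\<Sum>j\<in>I. if j = k then c j else 0)"
      using that by (intro sum.cong) (auto simp: dual')
    also have "\<dots> = c k"
      using that \<open>finite I\<close> by simp
    finally show ?thesis .
  qed
  have inj: "inj_on v I"
  proof (rule inj_onI)
    fix j k assume "j \<in> I" "k \<in> I" "v j = v k"
    then show "j = k"
      using dual'[of j k] dual'[of k k] by (metis zero_neq_one)
  qed
  have indep: "vec.independent (v ` I)"
  proof (rule vec.independent_if_scalars_zero)
    fix f x assume f: "(\<Sum>x\<in>v ` I. f x *s x) = 0" and "x \<in> v ` I"
    then obtain k where k: "k \<in> I" "x = v k"
      by auto
    have "(\<Sum>j\<in>I. (f \<circ> v) j *s v j) = 0"
      using f by (simp add: sum.reindex[OF inj])
    then show "f x = 0"
      using coord[OF k(1), of "f \<circ> v"] k by simp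
  qed (use assms in simp)
  have "v j \<in> vec.span (rows ?P)" if "j \<in> I" for j
  proof -
    \<comment> \<open>Weighting the rows by \<open>w j\<close> isolates the single summand
      \<open>v j\<close>.\<close>
    have "(\<Sum>i\<in>UNIV. w j $ i *s row i ?P) = (\<Sum>k\<in>I. (\<Sum>i\<in>UNIV. w j $ i * u k $ i) *s v k)"
      by (simp add: row vec_eq_iff sum_distrib_left sum_distrib_right sum.swap[of _ I] mult.assoc)
    also have "\<dots> = (\<Sum>k\<in>I. if j = k then v k else 0)"
      using that by (intro sum.cong) (auto simp: dual)
    also have "\<dots> = v j"
      using that \<open>finite I\<close> by simp
    finally have eq: "v j = (\<Sum>i\<in>UNIV. w j $ i *s row i ?P)" ..
    have "row i ?P \<in> rows ?P" for i
      by (auto simp: rows_def)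
    then show ?thesis
      unfolding eq by (intro vec.span_sum vec.span_scale vec.span_base)
  qed
  moreover have "rows ?P \<subseteq> vec.span (v ` I)"
  proof -
    have "row i ?P \<in> vec.span (v ` I)" for i
      unfolding row by (intro vec.span_sum vec.span_scale vec.span_base imageI)
    then show ?thesis
      unfolding rows_def by blast
  qed
  ultimately have "vec.span (rows ?P) = vec.span (v ` I)"
    by (intro vec.span_eq[THEN iffD2]) auto
  then have "rank ?P = card (v ` I)"
    unfolding row_rank_def_gen by (rule vec.dim_eq_card[OF _ indep, OF sym])
  then show ?thesis
    by (simp add: card_image[OF inj])
qed

text \<open>An outer product satisfies \<open>P ** P = trace P * P\<close> entrywise, so idempotence
  forces trace 1 at any nonzero entry.\<close>

lemma rank_1_idempotent_trace:
  fixes P :: "'a::field ^ 'm ^ 'm"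
  assumes "rank P = 1" "P ** P = P"
  shows "trace P = 1"
proof -
  obtain u v where P: "P = outer_product u v"
    using rank_1_outer_product[OF assms(1)] .
  have "P \<noteq> 0"
  proof
    assume "P = 0"
    then have "rows P \<subseteq> {0}"
      by (auto simp: rows_def row_def vec_eq_iff)
    then have "rank P = 0"
      by (simp add: row_rank_def_gen)
    with assms show False
      by simp
  qed
  then obtain i j where "P $ i $ j \<noteq> 0"
    by (auto simp: vec_eq_iff)
  moreover have "trace P * (u $ i * v $ j) = u $ i * v $ j"
  proof -
    have "(P ** P) $ i $ j = P $ i $ j"
      by (simp add: assms(2))
    then show ?thesis
      unfolding P outer_product_mult trace_outer_product by (simp add: outer_product_def)
  qed
  ultimately show ?thesis
    by (simp add: P outer_product_def)
qed

text \<open>Write each \<open>\<pi> i\<close> as an outer product of \<open>u i\<close> and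
  \<open>v i\<close>. Trace 1 and mutual orthogonality make \<open>u\<close> and \<open>v\<close>
  biorthogonal, so each is the dual family of the other.\<close>

lemma rank_sum_orthogonal_rank_1:
  fixes \<pi> :: "'b \<Rightarrow> 'a::field ^ 'm ^ 'm"
  assumes "finite I" and rank: "\<And>i. i \<in> I \<Longrightarrow> rank (\<pi> i) = 1"
    and idem: "\<And>i. i \<in> I \<Longrightarrow> \<pi> i ** \<pi> i = \<pi> i"
    and orth: "\<And>i j. i \<in> I \<Longrightarrow> j \<in> I \<Longrightarrow> i \<noteq> j \<Longrightarrow> \<pi> i ** \<pi> j = 0"
  shows "rank (\<Sum>i\<in>I. \<pi> i) = card I"
proof -
  have "\<forall>i\<in>I. \<exists>p. \<pi> i = outer_product (fst p) (snd p)"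
    using rank_1_outer_product[OF rank] by (metis fst_conv snd_conv)
  then obtain p where p: "\<forall>i\<in>I. \<pi> i = outer_product (fst (p i)) (snd (p i))"
    by metis
  define u v where "u = fst \<circ> p" and "v = snd \<circ> p"
  have \<pi>: "\<pi> i = outer_product (u i) (v i)" if "i \<in> I" for i
    using p that by (simp add: u_def v_def)
  have dual: "(\<Sum>i\<in>UNIV. v j $ i * u k $ i) = (if j = k then 1 else 0)" if "j \<in> I" "k \<in> I" for j k
  proof (cases "j = k")
    case True
    then show ?thesis
      using rank_1_idempotent_trace[OF rank idem, OF that(1) that(1)] \<pi>[OF that(1)]
      by (simp add: trace_outer_product)
  next
    case False
    \<comment> \<open>Ensures nonzero entries of \<open>u j\<close> and \<open>v k\<close>, so that
      the vanishing product \<open>\<pi> j ** \<pi> k\<close> forces its scalar factor, the pairing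
      of \<open>v j\<close> with \<open>u k\<close>, to be zero.\<close>
    have "trace (\<pi> j) \<noteq> 0" "trace (\<pi> k) \<noteq> 0"
      using that by (simp_all add: rank_1_idempotent_trace rank idem)
    then have "\<exists>a. u j $ a \<noteq> 0" "\<exists>b. v k $ b \<noteq> 0"
      using \<pi> that by (auto simp: trace_outer_product intro: ccontr)
    then obtain a b where "u j $ a \<noteq> 0" "v k $ b \<noteq> 0"
      by auto
    moreover have "(\<Sum>i\<in>UNIV. v j $ i * u k $ i) * (u j $ a * v k $ b) = 0"
    proof -
      have "(\<pi> j ** \<pi> k) $ a $ b = 0"
        by (simp add: orth[OF that False])
      then show ?thesis
        unfolding \<pi>[OF that(1)] \<pi>[OF that(2)] outer_product_mult by simp
    qed
    ultimately show ?thesis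
      using False by simp
  qed
  have "(\<Sum>i\<in>I. \<pi> i) = (\<Sum>i\<in>I. outer_product (u i) (v i))"
    using \<pi> by simp
  then show ?thesis
    using rank_sum_outer_products[of I v u v u, OF \<open>finite I\<close> dual dual] by simp
qed

section \<open>Block projections\<close>

lemma of_nat_mult_pos:
  fixes x :: "'a::{semiring_1,ordered_comm_monoid_add}"
  assumes "0 < x" "0 < n"
  shows "0 < of_nat n * x"
  \<comment> \<open>The order is only compatible with addition, so positivity comes from repeated
    addition.\<close>
  using assms(2)
proof (induction n rule: nat_induct_non_zero)
  case (Suc n)
  then show ?case
    using \<open>0 < x\<close> by (simp add: distrib_right add_pos_pos)
qed (use assms in simp)

lemma positive_definite_mat_of_nat:
  assumes "0 < n"
  shows "positive_definite (mat (of_nat n) :: 'a::conjugatable_ordered_field ^ 'm ^ 'm)"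
proof -
  \<comment> \<open>Conjugation is multiplicative, so \<open>conjugate 1\<close> is a nonzero
    idempotent of a field.\<close>
  have "conjugate (1 :: 'a) * conjugate 1 = conjugate 1 * 1"
    by (metis conjugate_dist_mul mult_1_right)
  then have conj_1: "conjugate (1 :: 'a) = 1"
    by simp
  have conj: "conjugate (of_nat n :: 'a) = of_nat n" for n
    by (induction n) (simp_all add: conjugate_dist_add conj_1)
  have "0 < (\<Sum>i\<in>UNIV. conjugate (x $ i) * ((mat (of_nat n) :: 'a ^ 'm ^ 'm) *v x) $ i)"
    if "x \<noteq> 0" for x
  proof -
    obtain j where "x $ j \<noteq> 0"
      using \<open>x \<noteq> 0\<close> by (auto simp: vec_eq_iff)
    then have "0 < (\<Sum>i\<in>UNIV. x $ i * conjugate (x $ i))"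
      by (intro sum_pos2[of _ j]) (auto simp: conjugate_square_positive)
    then have "0 < of_nat n * (\<Sum>i\<in>UNIV. x $ i * conjugate (x $ i))"
      using assms by (rule of_nat_mult_pos)
    also have "\<dots> = (\<Sum>i\<in>UNIV. conjugate (x $ i) * ((mat (of_nat n) :: 'a ^ 'm ^ 'm) *v x) $ i)"
    proof -
      have "((mat (of_nat n) :: 'a ^ 'm ^ 'm) *v x) $ i = of_nat n * x $ i" for i
        by (simp add: mat_def matrix_vector_mult_def if_distribR if_distrib[of "\<lambda>c. c * _"]
            cong: if_cong)
      then show ?thesis
        by (simp add: sum_distrib_left mult_ac)
    qed
    finally show ?thesis .
  qed
  moreover have "adjoint_matrix (mat (of_nat n) :: 'a ^ 'm ^ 'm) = mat (of_nat n)"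
    by (auto simp: adjoint_matrix_def mat_def vec_eq_iff conj)
  ultimately show ?thesis
    by (simp add: positive_definite_def)
qed

lemma symmetric_2_design_ETFF:
  fixes \<pi> :: "nat \<Rightarrow> 'a::{conjugatable_ordered_field,field_char_0} ^ 'm ^ 'm"
  assumes sym: "symmetric_block_design 2 CARD('m) l lam S"
    and bij: "bij_betw J {1..card S} S"
    and "0 < l" and dim: "2 \<le> CARD('m)"
    and frame: "tight_fusion_frame CARD('m) 1 \<pi>"
  shows "ETFF (card S) l (block_projections J \<pi>)"
proof -
  let ?m = "CARD('m)" and ?P = "block_projections J \<pi>"
  have D: "block_design 2 ?m l lam S" and b: "card S = ?m"
    using sym by (auto simp: symmetric_block_design_def)
  have finS: "finite S"
    using D by (rule block_design_finite)
  have J_in: "J i \<in> S" if "i \<in> {1..?m}" for i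
    using bij that b by (auto simp: bij_betw_def)
  have J: "J i \<subseteq> {1..?m}" "card (J i) = l" if "i \<in> {1..?m}" for i
    using block_design_subset[OF D J_in[OF that]] block_design_card[OF D J_in[OF that]] by auto
  have finJ: "finite (J i)" if "i \<in> {1..?m}" for i
    using J(1)[OF that] by (rule finite_subset) simp
  have proj: "orthogonal_projection (\<pi> j)" and rank: "rank (\<pi> j) = 1" if "j \<in> {1..?m}" for j
    using frame that by (auto simp: tight_fusion_frame_def fusion_frame_def packing_def)
  then have idem: "\<pi> j ** \<pi> j = \<pi> j" and adj: "adjoint_matrix (\<pi> j) = \<pi> j"
    if "j \<in> {1..?m}" for j
    using that by (auto simp: orthogonal_projection_def)
  \<comment> \<open>The tightness constant is \<open>?m * 1 / ?m\<close>, and characteristic zero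
    permits the cancellation.\<close>
  have sum: "(\<Sum>j=1..?m. \<pi> j) = mat 1"
    using frame by (simp add: tight_fusion_frame_def)
  have orth: "\<pi> j ** \<pi> k = 0" if "j \<in> {1..?m}" "k \<in> {1..?m}" "j \<noteq> k" for j k
    using projections_sum_id_orthogonal[OF finite_atLeastAtMost proj sum that] .
  \<comment> \<open>The case \<open>i = k\<close> yields idempotence, the case of distinct indices
    the pairwise traces.\<close>
  have prod: "?P i ** ?P k = (\<Sum>j\<in>J i \<inter> J k. \<pi> j)" if "i \<in> {1..?m}" "k \<in> {1..?m}" for i k
  proof -
    have "?P i ** ?P k = (\<Sum>a\<in>J i. \<Sum>b\<in>J k. \<pi> a ** \<pi> b)"
      unfolding block_projections_def matrix_mult_sum_left by (simp only: matrix_mult_sum_right)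
    also have "\<dots> = (\<Sum>a\<in>J i. \<Sum>b\<in>J k. if a = b then \<pi> a else 0)"
    proof (intro sum.cong refl)
      fix a b assume "a \<in> J i" "b \<in> J k"
      then have "a \<in> {1..?m}" "b \<in> {1..?m}"
        using J that by blast+
      then show "\<pi> a ** \<pi> b = (if a = b then \<pi> a else 0)"
        using orth idem by simp
    qed
    also have "\<dots> = (\<Sum>a\<in>J i. if a \<in> J k then \<pi> a else 0)"
      using finJ that by simp
    also have "\<dots> = (\<Sum>j\<in>J i \<inter> J k. \<pi> j)"
      using finJ that by (simp add: sum.inter_restrict)
    finally show ?thesis .
  qed
  have packing: "packing ?m l ?P"
    unfolding packing_def
  proof (intro ballI conjI)
    fix i assume i: "i \<in> {1..?m}"
    have "?P i ** ?P i = ?P i"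
      using prod[OF i i] by (simp add: block_projections_def)
    moreover have "adjoint_matrix (?P i) = ?P i"
      unfolding block_projections_def adjoint_matrix_sum
      using J(1)[OF i] adj by (intro sum.cong) auto
    ultimately show "orthogonal_projection (?P i)"
      by (simp add: orthogonal_projection_def)
    have "rank (?P i) = card (J i)"
      unfolding block_projections_def
      by (rule rank_sum_orthogonal_rank_1)
        (use finJ[OF i] J(1)[OF i] rank idem orth in \<open>blast+\<close>)
    then show "rank (?P i) = l"
      using J(2)[OF i] by simp
  qed
  \<comment> \<open>Exchange blocks and points: each \<open>\<pi> j\<close> occurs once for every
    block through \<open>j\<close>, that is \<open>l\<close> times.\<close>
  have "(\<Sum>i=1..?m. ?P i) = (\<Sum>B\<in>S. \<Sum>j\<in>B. \<pi> j)"
    unfolding block_projections_def using bij b by (simp add: sum.reindex_bij_betw)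
  also have "\<dots> = (\<Sum>B\<in>S. \<Sum>j=1..?m. if j \<in> B then \<pi> j else 0)"
  proof (rule sum.cong[OF refl])
    fix B assume "B \<in> S"
    then have "{1..?m} \<inter> B = B"
      using block_design_subset[OF D] by blast
    then show "(\<Sum>j\<in>B. \<pi> j) = (\<Sum>j=1..?m. if j \<in> B then \<pi> j else 0)"
      by (simp add: sum.inter_restrict[symmetric])
  qed
  also have "\<dots> = (\<Sum>j=1..?m. \<Sum>B\<in>S. if j \<in> B then \<pi> j else 0)"
    by (rule sum.swap)
  also have "\<dots> = (\<Sum>j=1..?m. \<Sum>B\<in>{B \<in> S. j \<in> B}. \<pi> j)"
    using finS by (simp only: sum.inter_filter)
  also have "\<dots> = mat (of_nat l)"
  proof -
    have "(\<Sum>j=1..?m. \<Sum>B\<in>{B \<in> S. j \<in> B}. \<pi> j) $ a $ c = of_nat l * (\<Sum>j=1..?m. \<pi> j) $ a $ c" for a c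
    proof -
      have "(\<Sum>j=1..?m. \<Sum>B\<in>{B \<in> S. j \<in> B}. \<pi> j) $ a $ c
          = (\<Sum>j=1..?m. \<Sum>B\<in>{B \<in> S. j \<in> B}. \<pi> j $ a $ c)"
        by (simp del: sum_constant)
      then show ?thesis
        using symmetric_block_design_replication[OF sym] by (simp add: sum_distrib_left)
    qed
    then show ?thesis
      unfolding sum by (simp add: vec_eq_iff mat_def)
  qed
  finally have "(\<Sum>i=1..?m. ?P i) = mat (of_nat l)" .
  then have "tight_fusion_frame ?m l ?P"
    using packing positive_definite_mat_of_nat[OF \<open>0 < l\<close>]
    by (simp add: tight_fusion_frame_def fusion_frame_def)
  moreover have "equiangular ?m ?P"
  proof -
    have "trace (?P i ** ?P k) = of_nat lam" if "i \<in> {1..?m}" "k \<in> {1..?m}" "i \<noteq> k" for i k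
    proof -
      have "J i \<noteq> J k"
        using inj_on_eq_iff[OF bij_betw_imp_inj_on[OF bij], unfolded b, OF that(1,2)] that(3)
        by simp
      then have "card (J i \<inter> J k) = lam"
        by (rule symmetric_2_design_inter_card[OF sym J_in[OF that(1)] J_in[OF that(2)]])
      moreover have "trace (\<pi> j) = 1" if "j \<in> J i \<inter> J k" for j
      proof -
        have "j \<in> {1..?m}"
          using that J(1)[OF \<open>i \<in> {1..?m}\<close>] by blast
        then show ?thesis
          by (intro rank_1_idempotent_trace rank idem)
      qed
      ultimately show ?thesis
        using prod[OF that(1,2)] by (simp add: trace_sum)
    qed
    then have "{trace (?P j ** ?P k) | j k. j \<in> {1..?m} \<and> k \<in> {1..?m} \<and> j \<noteq> k}
        = {of_nat lam | j k. j \<in> {1..?m} \<and> k \<in> {1..?m} \<and> j \<noteq> k}"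
      by (intro Collect_cong ex_cong1) auto
    \<comment> \<open>A singleton must be nonempty, so two distinct indices have to exist; dimension
      at least 2 supplies 1 and 2.\<close>
    moreover have "\<exists>j k. j \<in> {1..?m} \<and> k \<in> {1..?m} \<and> j \<noteq> k"
      using dim by (intro exI[of _ 1] exI[of _ 2]) auto
    ultimately show ?thesis
      by (simp add: equiangular_def is_singleton_def)
  qed
  ultimately show ?thesis
    by (simp add: ETFF_def b)
qed

text \<open>For \<open>t > l\<close> no block contains a \<open>t\<close>-set, so the index
  condition does not constrain pairs of points. When \<open>l = 1\<close> disjointness of distinct
  blocks takes its place.\<close>

theorem corollary5p3:
  fixes t l lam :: nat
    and S :: "nat set set"
    and J :: "nat \<Rightarrow> nat set"
  assumes "symmetric_block_design t CARD('m::finite) l lam S"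
    and "bij_betw J {1..card S} S"
    and "2 \<le> t"
    and "t \<le> l \<or> l = 1"
    and "2 \<le> CARD('m)"
  shows "(\<forall>\<pi> :: nat \<Rightarrow> real ^ 'm ^ 'm.
            tight_fusion_frame CARD('m) 1 \<pi> \<longrightarrow>
              ETFF (card S) l (block_projections J \<pi>)) \<and>
         (\<forall>\<pi> :: nat \<Rightarrow> complex ^ 'm ^ 'm.
            tight_fusion_frame CARD('m) 1 \<pi> \<longrightarrow>
              ETFF (card S) l (block_projections J \<pi>))"
proof -
  have D: "block_design t CARD('m) l lam S" and b: "card S = CARD('m)"
    using assms(1) by (auto simp: symmetric_block_design_def)
  have "\<exists>\<mu>. block_design 2 CARD('m) l \<mu> S"
    \<comment> \<open>If \<open>t \<le> l\<close> the strength drops from \<open>t\<close> to 2; if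
      \<open>l = 1\<close> the index is 0.\<close>
    using assms(3,4) D block_design_lower_strength[OF D] block_design_singletons by blast
  then obtain \<mu> where sym: "symmetric_block_design 2 CARD('m) l \<mu> S"
    using b by (auto simp: symmetric_block_design_def)
  have "0 < l"
    using assms(3,4) by auto
  show ?thesis
    by (intro conjI allI impI symmetric_2_design_ETFF[OF sym assms(2) \<open>0 < l\<close> assms(5)])
qed

end
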